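(* Let $\mathbb{X}$ be a finite-dimensional Euclidean space, $f:\mathbb{X}\to\mathbb{R}$ continuously differentiable, $P_1,P_2:\mathbb{X}\to\mathbb{R}$ convex with $P_1$ strongly convex, $\sigma>0$, and suppose $\mathcal{F}:=\{x\in\mathbb{X}:P_1(x)-P_2(x)\le\sigma\}$ is nonempty and compact. Suppose that for every $y\in\mathcal{F}$ and $\xi\in\partial P_2(y)$ there exists $x^\odot_{(y,\xi)}\in\mathbb{X}$ with $P_1(x^\odot_{(y,\xi)})-P_2(y)-\langle\xi,x^\odot_{(y,\xi)}-y\rangle<\sigma$. Suppose also that $\nabla f(x)\ne0$ for all $x\in\mathcal{F}$ and that there exists $L>0$ such that $\|\nabla f(x)-\nabla f(y)\|\le L\|x-y\|$ whenever $x,y\in\mathcal{F}$. Let $\{x^k\}$ be an infinite sequence generated by the Frank-Wolfe-type algorithm (FW) described in the context, and let $G:\mathcal{F}\to\mathbb{R}$ be defined by $G(x)=\inf_{\xi\in\partial P_2(x)}\max_{y\in\mathcal{F}(x,\xi)}\langle\nabla f(x),x-y\rangle$. Then $$\sum_{k=0}^\infty G(x^k)<+\infty\qquad\text{and}\qquad k\Big[\min_{0\le t\le k}G(x^t)\Big]\to0.$$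
   Context: $\partial P_i$ is the subdifferential of convex analysis. For $y\in\mathcal{F}$, $\xi\in\partial P_2(y)$: $\mathcal{F}(y,\xi):=\{x\in\mathbb{X}:P_1(x)-\langle\xi,x-y\rangle-P_2(y)\le\sigma\}$. For $a\in\mathbb{X}$, the linear-optimization oracle $\mathcal{LO}(a,y,\xi)$ returns a solution of $\min\{\langle a,x\rangle:x\in\mathcal{F}(y,\xi)\}$. Algorithm (FW). Step 0: Choose $x^0\in\mathcal{F}$, $c,\eta\in(0,1)$, and a sequence $\{\alpha_k^0\}\subseteq(0,1]$ with $\inf_k\alpha_k^0>0$. Set $k=0$. Step 1: Pick $\xi^k\in\partial P_2(x^k)$, let $u^k$ be an output of $\mathcal{LO}(\nabla f(x^k),x^k,\xi^k)$, and let $d^k:=u^k-x^k$. If $\langle\nabla f(x^k),d^k\rangle=0$, terminate. Step 2: Find $\alpha_k=\alpha_k^0\eta^{j_k}$ with $j_k$ the smallest nonnegative integer such that $f(x^k+\alpha_kd^k)\le f(x^k)+c\alpha_k\langle\nabla f(x^k),d^k\rangle$. Step 3: Set $\widehat x^{k+1}=x^k+\alpha_kd^k$. Choose $x^{k+1}\in\mathcal{F}$ such that $f(x^{k+1})\le f(\widehat x^{k+1})$. Update $k\leftarrow k+1$ and go to Step 1. *)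

theory Defs
  imports "HOL-Analysis.Analysis"
begin

definition strongly_convex_on :: "'a::real_inner set \<Rightarrow> ('a \<Rightarrow> real) \<Rightarrow> bool" where
  "strongly_convex_on S P \<longleftrightarrow> convex S \<and>
     (\<exists>\<mu>>0. \<forall>x\<in>S. \<forall>y\<in>S. \<forall>t\<in>{0..1}.
        P (t *\<^sub>R x + (1 - t) *\<^sub>R y)
          \<le> t * P x + (1 - t) * P y - \<mu> / 2 * t * (1 - t) * (norm (x - y))\<^sup>2)"

definition subdifferential :: "('a::real_inner \<Rightarrow> real) \<Rightarrow> 'a \<Rightarrow> 'a set" where
  "subdifferential P x = {\<xi>. \<forall>z. P z \<ge> P x + \<xi> \<bullet> (z - x)}"

definition feasible_set :: "('a \<Rightarrow> real) \<Rightarrow> ('a \<Rightarrow> real) \<Rightarrow> real \<Rightarrow> 'a set" where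
  "feasible_set P1 P2 \<sigma> = {x. P1 x - P2 x \<le> \<sigma>}"

definition feasible_approx ::
  "('a::real_inner \<Rightarrow> real) \<Rightarrow> ('a \<Rightarrow> real) \<Rightarrow> real \<Rightarrow> 'a \<Rightarrow> 'a \<Rightarrow> 'a set" where
  "feasible_approx P1 P2 \<sigma> y \<xi> = {x. P1 x - \<xi> \<bullet> (x - y) - P2 y \<le> \<sigma>}"

text \<open>A linear-optimization oracle may return any minimizer, so it is modelled by the relation
  saying that \<open>u\<close> is an admissible output for the input \<open>(a, y, \<xi>)\<close>.\<close>

definition LO_output ::
  "('a::real_inner \<Rightarrow> real) \<Rightarrow> ('a \<Rightarrow> real) \<Rightarrow> real \<Rightarrow> 'a \<Rightarrow> 'a \<Rightarrow> 'a \<Rightarrow> 'a \<Rightarrow> bool" where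
  "LO_output P1 P2 \<sigma> a y \<xi> u \<longleftrightarrow>
     is_arg_min (\<lambda>x. a \<bullet> x) (\<lambda>x. x \<in> feasible_approx P1 P2 \<sigma> y \<xi>) u"

definition armijo ::
  "('a::real_inner \<Rightarrow> real) \<Rightarrow> ('a \<Rightarrow> 'a) \<Rightarrow> real \<Rightarrow> 'a \<Rightarrow> 'a \<Rightarrow> real \<Rightarrow> bool" where
  "armijo f gradf c x d a \<longleftrightarrow> f (x + a *\<^sub>R d) \<le> f x + c * a * (gradf x \<bullet> d)"

text \<open>The sequence \<open>x\<close> is an infinite run of the Frank-Wolfe-type method: some admissible
  parameters and choices produce it, and the stopping test fails in every iteration.
  Minimality of the backtracking exponent \<open>j k\<close> is spelled out rather than written with
  \<open>LEAST\<close>, so that a run requires the line search to succeed.\<close>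

definition FW_sequence ::
  "('a::real_inner \<Rightarrow> real) \<Rightarrow> ('a \<Rightarrow> 'a) \<Rightarrow> ('a \<Rightarrow> real) \<Rightarrow> ('a \<Rightarrow> real) \<Rightarrow> real
     \<Rightarrow> (nat \<Rightarrow> 'a) \<Rightarrow> bool" where
  "FW_sequence f gradf P1 P2 \<sigma> x \<longleftrightarrow>
     (\<exists>(c::real) (\<eta>::real) (\<alpha>0::nat \<Rightarrow> real) \<xi> u d (\<alpha>::nat \<Rightarrow> real) (j::nat \<Rightarrow> nat) xhat.
        0 < c \<and> c < 1 \<and> 0 < \<eta> \<and> \<eta> < 1 \<and>
        range \<alpha>0 \<subseteq> {0<..1} \<and> (INF k. \<alpha>0 k) > 0 \<and>
        x 0 \<in> feasible_set P1 P2 \<sigma> \<and>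
        (\<forall>k. \<xi> k \<in> subdifferential P2 (x k) \<and>
             LO_output P1 P2 \<sigma> (gradf (x k)) (x k) (\<xi> k) (u k) \<and>
             d k = u k - x k \<and>
             gradf (x k) \<bullet> d k \<noteq> 0 \<and>
             \<alpha> k = \<alpha>0 k * \<eta> ^ j k \<and>
             armijo f gradf c (x k) (d k) (\<alpha> k) \<and>
             (\<forall>i<j k. \<not> armijo f gradf c (x k) (d k) (\<alpha>0 k * \<eta> ^ i)) \<and>
             xhat (Suc k) = x k + \<alpha> k *\<^sub>R d k \<and>
             x (Suc k) \<in> feasible_set P1 P2 \<sigma> \<and>
             f (x (Suc k)) \<le> f (xhat (Suc k))))"

text \<open>The inner supremum is the maximum of a linear function: for strongly convex \<open>P1\<close>, finite
  convex \<open>P2\<close> and feasible \<open>x\<close>, the set \<open>feasible_approx P1 P2 \<sigma> x \<xi>\<close> is compact and contains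
  \<open>x\<close>. Hence the outer infimum is over a nonempty set of nonnegative reals. Values at
  infeasible \<open>x\<close> are irrelevant.\<close>

definition FW_gap ::
  "('a::real_inner \<Rightarrow> 'a) \<Rightarrow> ('a \<Rightarrow> real) \<Rightarrow> ('a \<Rightarrow> real) \<Rightarrow> real \<Rightarrow> 'a \<Rightarrow> real" where
  "FW_gap gradf P1 P2 \<sigma> x =
     (INF \<xi>\<in>subdifferential P2 x. SUP y\<in>feasible_approx P1 P2 \<sigma> x \<xi>. gradf x \<bullet> (x - y))"

end

theory Submission
  imports Defs
begin

text \<open>
  The rate rests on a uniform strong convexity of the sets over which the oracle minimizes. Let
  \<open>y\<close> be feasible, \<open>\<xi>\<close> a subgradient of \<open>P2\<close> at \<open>y\<close> and \<open>u\<close> a minimizer of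
  \<open>g \<bullet> z\<close> over \<open>feasible_approx P1 P2 \<sigma> y \<xi>\<close>. By strong convexity of \<open>P1\<close>, the
  function defining this set has at the midpoint \<open>m\<close> of \<open>y\<close> and \<open>u\<close> a slack proportional to
  \<open>(norm (u - y))\<^sup>2\<close>, so a ball around \<open>m\<close> with a radius of that order stays inside the set.
  Moving from \<open>m\<close> in direction \<open>- g\<close> to the boundary of this ball and comparing with \<open>u\<close>
  gives \<open>- (g \<bullet> (u - y)) \<ge> \<kappa> * norm g * (norm (u - y))\<^sup>2\<close>
  (\<open>LO_output_quadratic_decrease\<close>). The constant \<open>\<kappa>\<close> does not depend on \<open>y\<close>, \<open>\<xi>\<close>,
  \<open>g\<close> or \<open>u\<close>, because subgradients of \<open>P2\<close> are bounded on a bounded set.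

  On the compact feasible set \<open>gradf\<close> is bounded away from zero, so along a run the predicted
  decrease \<open>- (gradf (x k) \<bullet> d k)\<close> dominates a fixed multiple of \<open>(norm (d k))\<^sup>2\<close>, which is
  also the order of the error of the linear model of \<open>f\<close> (\<open>descent_on_segment\<close>). Hence every
  sufficiently small step passes the Armijo test and backtracking keeps the step sizes above a
  positive constant \<open>a\<close> (\<open>backtracking_step_ge\<close>). Each iteration then lowers \<open>f\<close> by at least
  \<open>c * a\<close> times the predicted decrease. As \<open>f\<close> is bounded below on the feasible set, the
  predicted decreases are summable, and they dominate the gaps (\<open>FW_gap_bounds\<close>).

  The running minimum of the gaps is decreasing and summable, so by the classical theorem of
  Olivier (\<open>decreasing_summable_imp_times_index_tendsto_0\<close>) it is \<open>o(1/k)\<close>.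
\<close>

section \<open>Feasible approximations\<close>

text \<open>The affine minorant of \<open>P2\<close> at \<open>y\<close> lies below \<open>P2\<close>, so replacing \<open>P2\<close> by it only
  tightens the constraint. This makes the oracle's output feasible and, as the tightened set is
  convex, the whole segment searched by the line search.\<close>

lemma feasible_approx_subset_feasible:
  assumes "\<xi> \<in> subdifferential P2 y"
  shows "feasible_approx P1 P2 \<sigma> y \<xi> \<subseteq> feasible_set P1 P2 \<sigma>"
proof
  fix z assume "z \<in> feasible_approx P1 P2 \<sigma> y \<xi>"
  moreover have "P2 z \<ge> P2 y + \<xi> \<bullet> (z - y)"
    using assms by (simp add: subdifferential_def)
  ultimately show "z \<in> feasible_set P1 P2 \<sigma>"
    by (simp add: feasible_approx_def feasible_set_def)
qed

lemma center_in_feasible_approx: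
  "y \<in> feasible_set P1 P2 \<sigma> \<Longrightarrow> y \<in> feasible_approx P1 P2 \<sigma> y \<xi>"
  by (simp add: feasible_approx_def feasible_set_def)

lemma convex_on_feasible_approx_fun:
  fixes P1 P2 :: "'a::real_inner \<Rightarrow> real"
  assumes "convex_on UNIV P1"
  shows "convex_on UNIV (\<lambda>z. P1 z - \<xi> \<bullet> (z - y) - P2 y)"
proof -
  have "convex_on UNIV (\<lambda>z. \<xi> \<bullet> (y - z) - P2 y)"
    by (intro convex_onI) (simp_all add: algebra_simps inner_simps)
  then have "convex_on UNIV (\<lambda>z. P1 z + (\<xi> \<bullet> (y - z) - P2 y))"
    by (intro convex_on_add assms)
  moreover have "P1 z + (\<xi> \<bullet> (y - z) - P2 y) = P1 z - \<xi> \<bullet> (z - y) - P2 y" for z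
    by (simp add: inner_simps)
  ultimately show ?thesis by simp
qed

lemma convex_feasible_approx:
  fixes P1 P2 :: "'a::real_inner \<Rightarrow> real"
  assumes "convex_on UNIV P1"
  shows "convex (feasible_approx P1 P2 \<sigma> y \<xi>)"
proof (rule convexI)
  let ?h = "\<lambda>z. P1 z - \<xi> \<bullet> (z - y) - P2 y"
  fix a b :: 'a and s t :: real
  assume ab: "a \<in> feasible_approx P1 P2 \<sigma> y \<xi>" "b \<in> feasible_approx P1 P2 \<sigma> y \<xi>"
    and st: "0 \<le> s" "0 \<le> t" "s + t = 1"
  have "?h (s *\<^sub>R a + t *\<^sub>R b) \<le> s * ?h a + t * ?h b"
    using convex_on_feasible_approx_fun[OF assms, of \<xi> y P2] st
    unfolding convex_on_def by blast
  also have "\<dots> \<le> \<sigma>"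
    using ab st by (intro convex_bound_le) (auto simp: feasible_approx_def)
  finally show "s *\<^sub>R a + t *\<^sub>R b \<in> feasible_approx P1 P2 \<sigma> y \<xi>"
    by (simp add: feasible_approx_def)
qed

section \<open>Quadratic lower bound for the linear decrease\<close>

lemma inner_sgn_self: "g \<bullet> sgn g = norm g" for g :: "'a::real_inner"
  by (cases "g = 0") (simp_all add: sgn_div_norm dot_square_norm power2_eq_square field_simps)

text \<open>Test the subgradient inequality one unit away from \<open>x\<close> in the direction of \<open>\<xi>\<close>.\<close>

lemma subgradient_norm_le:
  assumes "\<xi> \<in> subdifferential P x"
    and "\<And>z. z \<in> cball x 1 \<Longrightarrow> \<bar>P z\<bar> \<le> M"
  shows "norm \<xi> \<le> 2 * M"
proof -
  let ?w = "sgn \<xi>"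
  have "norm ?w \<le> 1" by (simp add: norm_sgn)
  then have "x + ?w \<in> cball x 1" by (simp add: dist_norm)
  then have "\<bar>P (x + ?w)\<bar> \<le> M" "\<bar>P x\<bar> \<le> M"
    using assms(2)[of "x + ?w"] assms(2)[of x] by auto
  moreover have "P (x + ?w) \<ge> P x + \<xi> \<bullet> (x + ?w - x)"
    using assms(1) by (simp only: subdifferential_def) blast
  moreover have "\<xi> \<bullet> ?w = norm \<xi>" by (rule inner_sgn_self)
  ultimately show ?thesis by simp
qed

text \<open>On a radius of the unit ball around \<open>m\<close>, the convex function \<open>h\<close> lies below a line that
  starts at \<open>\<sigma> - q\<close> and ends at \<open>B\<close>. Its slope is at most \<open>C\<close>, so the slack \<open>q\<close> lasts for a
  distance of at least \<open>q / C\<close>. This replaces a Lipschitz estimate for \<open>h\<close>.\<close>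

lemma sublevel_slack_cball:
  fixes h :: "'a::real_normed_vector \<Rightarrow> real"
  assumes h: "convex_on UNIV h"
    and slack: "h m \<le> \<sigma> - q"
    and bound: "\<And>w. norm w \<le> 1 \<Longrightarrow> h (m + w) \<le> B"
    and q: "0 \<le> q" "q \<le> C" and C: "0 < C" "B - \<sigma> + q \<le> C"
  shows "cball m (q / C) \<subseteq> {z. h z \<le> \<sigma>}"
proof
  fix z assume z: "z \<in> cball m (q / C)"
  define s where "s = q / C"
  have s: "0 \<le> s" "s \<le> 1" "s * C = q" using q C by (auto simp: s_def)
  (* If s = 0, then z = m and division by zero gives w = 0, so the bounds below still hold. *)
  define w where "w = (1 / s) *\<^sub>R (z - m)"
  have nz: "norm (z - m) \<le> s" using z by (simp add: s_def dist_norm norm_minus_commute)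
  have zw: "z = (1 - s) *\<^sub>R m + s *\<^sub>R (m + w)"
    using nz s by (cases "s = 0") (auto simp: w_def algebra_simps)
  have "norm w = norm (z - m) / s" using s unfolding w_def norm_scaleR by simp
  then have w: "norm w \<le> 1"
    using nz s by (cases "s = 0") simp_all
  have "h z \<le> (1 - s) * h m + s * h (m + w)"
    unfolding zw using s by (intro convex_onD[OF h]) auto
  also have "\<dots> \<le> (1 - s) * (\<sigma> - q) + s * B"
    using s slack bound[OF w] by (intro add_mono mult_left_mono) auto
  also have "\<dots> = \<sigma> - q + s * (B - \<sigma> + q)" by (simp add: algebra_simps)
  also have "\<dots> \<le> \<sigma> - q + s * C" using s C by (intro add_mono mult_left_mono) auto
  finally show "z \<in> {z. h z \<le> \<sigma>}" using s by simp
qed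

lemma linear_min_le_cball:
  fixes g :: "'a::real_inner"
  assumes "cball m r \<subseteq> S" "0 \<le> r" and "\<And>z. z \<in> S \<Longrightarrow> g \<bullet> u \<le> g \<bullet> z"
  shows "g \<bullet> u \<le> g \<bullet> m - r * norm g"
proof -
  have "norm (r *\<^sub>R sgn g) \<le> r" using assms(2) by (simp add: norm_sgn)
  then have "m - r *\<^sub>R sgn g \<in> cball m r" by (simp add: dist_norm)
  then have "g \<bullet> u \<le> g \<bullet> (m - r *\<^sub>R sgn g)" using assms by blast
  also have "\<dots> = g \<bullet> m - r * norm g"
    by (simp add: inner_diff_right inner_sgn_self)
  finally show ?thesis .
qed

lemma convex_bounded_on_cball:
  fixes P :: "'a::euclidean_space \<Rightarrow> real"
  assumes "convex_on UNIV P"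
  obtains M where "\<And>z. z \<in> cball a r \<Longrightarrow> \<bar>P z\<bar> \<le> M"
proof -
  have cont: "continuous_on UNIV P" by (intro convex_on_continuous assms open_UNIV)
  have "compact (P ` cball a r)"
    by (intro compact_continuous_image continuous_on_subset[OF cont]) auto
  then have "bounded (P ` cball a r)" by (rule compact_imp_bounded)
  then show ?thesis using that unfolding bounded_iff by (metis imageI real_norm_def)
qed

text \<open>The slack at the midpoint of \<open>y\<close> and \<open>u\<close> is \<open>\<mu> / 8 * (norm (u - y))\<^sup>2\<close>. What has to be
  checked is that the bound \<open>B\<close> on the defining function over a unit ball around the midpoint,
  and hence the slope \<open>C\<close>, can be chosen uniformly: it involves only the radius \<open>R\<close> of the
  feasible set and bounds for \<open>P1\<close>, \<open>P2\<close> and \<open>\<xi>\<close> on a neighbourhood of width one.\<close>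

lemma LO_output_quadratic_decrease:
  fixes P1 P2 :: "'a::euclidean_space \<Rightarrow> real"
  assumes P1_convex: "convex_on UNIV P1" and P2_convex: "convex_on UNIV P2"
    and P1_strong: "strongly_convex_on UNIV P1"
    and F: "bounded (feasible_set P1 P2 \<sigma>)"
  obtains \<kappa> where "\<kappa> > 0"
    and "\<And>y \<xi> g u. y \<in> feasible_set P1 P2 \<sigma> \<Longrightarrow> \<xi> \<in> subdifferential P2 y \<Longrightarrow>
      LO_output P1 P2 \<sigma> g y \<xi> u \<Longrightarrow> \<kappa> * norm g * (norm (u - y))\<^sup>2 \<le> - (g \<bullet> (u - y))"
proof -
  obtain \<mu> where \<mu>: "\<mu> > 0"
    and strong: "\<And>x y t. t \<in> {0..1} \<Longrightarrow> P1 (t *\<^sub>R x + (1 - t) *\<^sub>R y)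
          \<le> t * P1 x + (1 - t) * P1 y - \<mu> / 2 * t * (1 - t) * (norm (x - y))\<^sup>2"
    using P1_strong unfolding strongly_convex_on_def by blast
  obtain R where R: "0 < R" "\<And>z. z \<in> feasible_set P1 P2 \<sigma> \<Longrightarrow> norm z \<le> R"
    using F by (auto simp: bounded_pos)
  obtain M1 where M1: "\<And>z. z \<in> cball 0 (R + 1) \<Longrightarrow> \<bar>P1 z\<bar> \<le> M1"
    by (rule convex_bounded_on_cball[OF P1_convex, of 0 "R + 1"]) blast
  obtain M2 where M2: "\<And>z. z \<in> cball 0 (R + 1) \<Longrightarrow> \<bar>P2 z\<bar> \<le> M2"
    by (rule convex_bounded_on_cball[OF P2_convex, of 0 "R + 1"]) blast
  define B where "B = M1 + 2 * M2 * (2 * R + 1) + M2"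
  define Q where "Q = \<mu> / 8 * (2 * R)\<^sup>2"
  define C where "C = max 1 (max Q (B - \<sigma> + Q))"
  have C: "C > 0" "Q \<le> C" "B - \<sigma> + Q \<le> C" by (auto simp: C_def)
  show thesis
  proof (rule that[of "\<mu> / (4 * C)"])
    show "\<mu> / (4 * C) > 0" using \<mu> C by simp
    fix y \<xi> g u
    assume y: "y \<in> feasible_set P1 P2 \<sigma>" and \<xi>: "\<xi> \<in> subdifferential P2 y"
      and LO: "LO_output P1 P2 \<sigma> g y \<xi> u"
    define h where "h = (\<lambda>z. P1 z - \<xi> \<bullet> (z - y) - P2 y)"
    have FA: "feasible_approx P1 P2 \<sigma> y \<xi> = {z. h z \<le> \<sigma>}"
      by (simp add: feasible_approx_def h_def)
    have u: "h u \<le> \<sigma>" and umin: "\<And>z. z \<in> {z. h z \<le> \<sigma>} \<Longrightarrow> g \<bullet> u \<le> g \<bullet> z"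
      using LO unfolding LO_output_def is_arg_min_linorder FA by auto
    have uF: "u \<in> feasible_set P1 P2 \<sigma>"
      using u FA feasible_approx_subset_feasible[OF \<xi>] by blast
    have hy: "h y \<le> \<sigma>" using center_in_feasible_approx[OF y] FA by blast
    define m where "m = (1 / 2) *\<^sub>R u + (1 / 2) *\<^sub>R y"
    define q where "q = \<mu> / 8 * (norm (u - y))\<^sup>2"
    have ny: "norm y \<le> R" and nu: "norm u \<le> R" using R y uF by auto
    have nuy: "norm (u - y) \<le> 2 * R" using norm_triangle_ineq4[of u y] ny nu by linarith
    have q: "0 \<le> q" "q \<le> Q"
      unfolding q_def Q_def using \<mu> by (simp, intro mult_left_mono power_mono nuy) simp_all
    have "P1 m \<le> P1 u / 2 + P1 y / 2 - q"
      using strong[of "1/2" u y] by (simp add: m_def q_def)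
    moreover have "\<xi> \<bullet> (m - y) = \<xi> \<bullet> (u - y) / 2"
      by (simp add: m_def algebra_simps inner_simps)
    ultimately have hm: "h m \<le> \<sigma> - q"
      using u hy by (simp add: h_def)
    have nm: "norm m \<le> R"
    proof -
      have "norm m \<le> norm ((1 / 2) *\<^sub>R u) + norm ((1 / 2) *\<^sub>R y)"
        unfolding m_def by (rule norm_triangle_ineq)
      then show ?thesis using ny nu by simp
    qed
    have n\<xi>: "norm \<xi> \<le> 2 * M2"
    proof (rule subgradient_norm_le[OF \<xi>])
      fix z assume "z \<in> cball y 1"
      then have "z \<in> cball 0 (R + 1)"
        using ny norm_triangle_ineq2[of z y] by (simp add: dist_norm norm_minus_commute)
      then show "\<bar>P2 z\<bar> \<le> M2" by (rule M2)
    qed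
    have hB: "h (m + w) \<le> B" if w: "norm w \<le> 1" for w
    proof -
      have mw: "norm (m + w) \<le> R + 1" using norm_triangle_ineq[of m w] nm w by linarith
      have "norm (m + w - y) \<le> 2 * R + 1"
        using norm_triangle_ineq4[of "m + w" y] mw ny by linarith
      then have "norm \<xi> * norm (m + w - y) \<le> 2 * M2 * (2 * R + 1)"
        using n\<xi> order_trans[OF norm_ge_zero n\<xi>] by (intro mult_mono) auto
      then have "\<bar>\<xi> \<bullet> (m + w - y)\<bar> \<le> 2 * M2 * (2 * R + 1)"
        using Cauchy_Schwarz_ineq2[of \<xi> "m + w - y"] by linarith
      moreover have "\<bar>P1 (m + w)\<bar> \<le> M1" using M1 mw by simp
      moreover have "\<bar>P2 y\<bar> \<le> M2" using M2 ny by simp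
      ultimately show ?thesis unfolding h_def B_def by linarith
    qed
    define r where "r = q / C * norm g"
    have "cball m (q / C) \<subseteq> {z. h z \<le> \<sigma>}"
      using convex_on_feasible_approx_fun[OF P1_convex, of \<xi> y P2] hm hB q C
      unfolding h_def[symmetric] by (intro sublevel_slack_cball[where B = B]) auto
    then have drop: "g \<bullet> u \<le> g \<bullet> m - r" unfolding r_def
      using q C umin by (intro linear_min_le_cball) auto
    have mid: "g \<bullet> m = (g \<bullet> u + g \<bullet> y) / 2"
      by (simp add: m_def inner_simps)
    have "\<mu> / (4 * C) * norm g * (norm (u - y))\<^sup>2 = 2 * r"
      by (simp add: r_def q_def)
    also have "\<dots> \<le> g \<bullet> y - g \<bullet> u"
      using drop mid by (simp add: field_simps)
    finally show "\<mu> / (4 * C) * norm g * (norm (u - y))\<^sup>2 \<le> - (g \<bullet> (u - y))"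
      by (simp add: inner_diff_right)
  qed
qed

section \<open>Step sizes\<close>

text \<open>The Lipschitz bound is available only on \<open>S\<close>, so the mean value theorem is applied on the
  segment, which convexity keeps inside \<open>S\<close>. It yields \<open>L\<close> in place of the sharp \<open>L / 2\<close>; only
  the order of the error term matters for the rate.\<close>

lemma descent_on_segment:
  fixes f :: "'a::real_inner \<Rightarrow> real"
  assumes grad: "\<And>z. GDERIV f z :> gradf z"
    and S: "convex S" "x \<in> S" "x + d \<in> S"
    and lip: "\<And>y z. y \<in> S \<Longrightarrow> z \<in> S \<Longrightarrow> norm (gradf y - gradf z) \<le> L * norm (y - z)"
    and b: "0 \<le> b" "b \<le> 1" and L: "0 \<le> L"
  shows "f (x + b *\<^sub>R d) \<le> f x + b * (gradf x \<bullet> d) + L * b\<^sup>2 * (norm d)\<^sup>2"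
proof -
  define \<phi> where "\<phi> = (\<lambda>t. f (x + t *\<^sub>R d))"
  have deriv: "(\<phi> has_derivative (\<lambda>s. s * (gradf (x + t *\<^sub>R d) \<bullet> d))) (at t)" for t
  proof -
    have "(f has_derivative (\<lambda>h. h \<bullet> gradf (x + t *\<^sub>R d))) (at (x + t *\<^sub>R d))"
      using grad by (simp add: gderiv_def inner_commute)
    moreover have "((\<lambda>t. x + t *\<^sub>R d) has_derivative (\<lambda>s. s *\<^sub>R d)) (at t)"
      by (auto intro!: derivative_eq_intros)
    ultimately show ?thesis
      unfolding \<phi>_def by (auto dest: has_derivative_compose simp: inner_commute)
  qed
  show ?thesis
  proof (cases "b = 0")
    case False
    then have "0 < b" using b by simp
    then obtain t where t: "0 < t" "t < b"
      and increment: "\<phi> b - \<phi> 0 = (b - 0) * (gradf (x + t *\<^sub>R d) \<bullet> d)"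
      by (rule mvt[of 0 b \<phi>, OF _ continuous_at_imp_continuous_on deriv])
        (auto intro: has_derivative_continuous[OF deriv])
    have xt: "x + t *\<^sub>R d \<in> S"
    proof -
      have "(1 - t) *\<^sub>R x + t *\<^sub>R (x + d) \<in> S"
        using S t b by (intro convexD) auto
      then show ?thesis by (simp add: algebra_simps)
    qed
    have "(gradf (x + t *\<^sub>R d) - gradf x) \<bullet> d \<le> norm (gradf (x + t *\<^sub>R d) - gradf x) * norm d"
      by (rule norm_cauchy_schwarz)
    also have "\<dots> \<le> L * norm (t *\<^sub>R d) * norm d"
      using lip[OF xt S(2)] by (intro mult_right_mono) auto
    also have "\<dots> = L * t * (norm d)\<^sup>2" using t by (simp add: power2_eq_square)
    also have "\<dots> \<le> L * b * (norm d)\<^sup>2"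
      using t L by (intro mult_right_mono mult_left_mono) auto
    finally have "gradf (x + t *\<^sub>R d) \<bullet> d \<le> gradf x \<bullet> d + L * b * (norm d)\<^sup>2"
      by (simp add: inner_diff_left)
    then have "b * (gradf (x + t *\<^sub>R d) \<bullet> d) \<le> b * (gradf x \<bullet> d + L * b * (norm d)\<^sup>2)"
      using b by (intro mult_left_mono)
    also have "\<dots> = b * (gradf x \<bullet> d) + L * b\<^sup>2 * (norm d)\<^sup>2"
      by (simp only: power2_eq_square distrib_left mult_ac)
    finally show ?thesis using increment by (simp add: \<phi>_def)
  qed simp
qed

lemma armijo_if_small_step:
  fixes f :: "'a::real_inner \<Rightarrow> real"
  assumes desc: "f (x + b *\<^sub>R d) \<le> f x + b * (gradf x \<bullet> d) + L * b\<^sup>2 * (norm d)\<^sup>2"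
    and dec: "\<kappa> * (norm d)\<^sup>2 \<le> - (gradf x \<bullet> d)"
    and b: "0 \<le> b" "L * b \<le> (1 - c) * \<kappa>" and c: "c < 1"
  shows "armijo f gradf c x d b"
proof -
  have "L * b * (norm d)\<^sup>2 \<le> (1 - c) * \<kappa> * (norm d)\<^sup>2"
    using b by (intro mult_right_mono) auto
  also have "\<dots> \<le> (1 - c) * - (gradf x \<bullet> d)"
    using dec c unfolding mult.assoc by (intro mult_left_mono) auto
  finally have "b * (L * b * (norm d)\<^sup>2) \<le> b * ((1 - c) * - (gradf x \<bullet> d))"
    using b by (intro mult_left_mono)
  then show ?thesis using desc unfolding armijo_def
    by (simp add: power2_eq_square algebra_simps)
qed

text \<open>Either the first trial is accepted, or the trial before the accepted one was rejected and
  hence exceeds the threshold \<open>\<tau>\<close>; the accepted one is smaller by a single factor \<open>\<eta>\<close>.\<close>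

lemma backtracking_step_ge:
  fixes a \<eta> \<tau> :: real
  assumes "0 < a" "a \<le> 1" "0 < \<eta>" "\<eta> < 1"
    and ok: "\<And>b. 0 \<le> b \<Longrightarrow> b \<le> 1 \<Longrightarrow> b \<le> \<tau> \<Longrightarrow> A b"
    and rej: "\<And>i. i < j \<Longrightarrow> \<not> A (a * \<eta> ^ i)"
  shows "min a (\<eta> * \<tau>) \<le> a * \<eta> ^ j"
proof (cases j)
  case (Suc i)
  have "a * \<eta> ^ i \<le> 1" using assms by (intro mult_le_one power_le_one) auto
  moreover have "0 \<le> a * \<eta> ^ i" using assms by simp
  ultimately have "\<not> a * \<eta> ^ i \<le> \<tau>"
    using ok[of "a * \<eta> ^ i"] rej[of i] Suc by blast
  then have "\<eta> * \<tau> \<le> \<eta> * (a * \<eta> ^ i)" using assms by (intro mult_left_mono) auto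
  then show ?thesis using Suc by (simp add: mult_ac min_le_iff_disj)
qed simp

section \<open>Series\<close>

lemma summable_of_telescoping:
  fixes e v :: "nat \<Rightarrow> real"
  assumes "\<And>k. 0 \<le> e k" and "\<And>k. e k \<le> v k - v (Suc k)" and "\<And>k. B \<le> v k"
  shows "summable e"
proof (rule bounded_imp_summable[where B = "v 0 - B"])
  fix n
  have "(\<Sum>k\<le>n. e k) \<le> (\<Sum>k\<le>n. v k - v (Suc k))" by (intro sum_mono assms)
  also have "\<dots> = v 0 - v (Suc n)" by (rule sum_telescope)
  finally show "(\<Sum>k\<le>n. e k) \<le> v 0 - B" using assms(3)[of "Suc n"] by linarith
qed (use assms in auto)

text \<open>Olivier's theorem: the second half of the first \<open>k\<close> terms has about \<open>k / 2\<close> terms, each at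
  least \<open>m k\<close>, and is bounded by a tail of the series.\<close>

lemma decreasing_summable_imp_times_index_tendsto_0:
  fixes m :: "nat \<Rightarrow> real"
  assumes m: "summable m" "\<And>k. 0 \<le> m k" "decseq m"
  shows "(\<lambda>k. real k * m k) \<longlonglongrightarrow> 0"
proof -
  define T where "T = (\<lambda>n. \<Sum>i. m (i + n))"
  have T0: "T \<longlonglongrightarrow> 0" unfolding T_def by (rule suminf_exist_split2[OF m(1)])
  have "filterlim (\<lambda>k::nat. k div 2) at_top at_top"
    by (rule filterlim_at_top_div_const_nat) simp
  then have lim: "(\<lambda>k. 2 * T (k div 2)) \<longlonglongrightarrow> 0"
    using filterlim_compose[OF T0] tendsto_mult_right_zero by blast
  have le: "real k * m k \<le> 2 * T (k div 2)" for k
  proof -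
    let ?n = "k div 2" and ?l = "k - k div 2"
    (* The half is rounded up, so that real k is at most twice its length for odd k as well. *)
    have "real ?l * m k = (\<Sum>i<?l. m k)" by simp
    also have "\<dots> \<le> (\<Sum>i<?l. m (i + ?n))"
      by (intro sum_mono decseqD[OF m(3)]) auto
    also have "\<dots> \<le> T ?n" unfolding T_def
      using m by (intro sum_le_suminf) (auto simp: summable_iff_shift)
    finally have "real ?l * m k \<le> T ?n" .
    moreover have "real k * m k \<le> (2 * real ?l) * m k"
      using m(2) by (intro mult_right_mono) linarith+
    ultimately show ?thesis by linarith
  qed
  show ?thesis
    by (rule real_tendsto_sandwich[OF _ _ tendsto_const lim]) (use le m(2) in auto)
qed

lemma times_running_Min_tendsto_0:
  fixes G :: "nat \<Rightarrow> real"
  assumes "summable G" "\<And>k. 0 \<le> G k"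
  shows "(\<lambda>k. real k * (MIN t\<in>{0..k}. G t)) \<longlonglongrightarrow> 0"
proof (rule decreasing_summable_imp_times_index_tendsto_0)
  show nonneg: "0 \<le> (MIN t\<in>{0..k}. G t)" for k
    using assms(2) by (subst Min_ge_iff) auto
  show "summable (\<lambda>k. MIN t\<in>{0..k}. G t)"
    using nonneg by (intro summable_comparison_test'[OF assms(1), of 0]) auto
  show "decseq (\<lambda>k. MIN t\<in>{0..k}. G t)"
    by (intro decseq_SucI Min_antimono) auto
qed

section \<open>The gap function\<close>

text \<open>The oracle's output attains the inner supremum at its own \<open>\<xi>\<close>, and the infimum over all
  subgradients is at most that value. Boundedness of the feasible set is needed so that the
  suprema are genuine: taking \<open>y = x\<close> shows that each is nonnegative, which gives the lower
  bound and makes the infimum meaningful.\<close>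

lemma FW_gap_bounds:
  fixes P1 P2 :: "'a::euclidean_space \<Rightarrow> real"
  assumes F: "bounded (feasible_set P1 P2 \<sigma>)" and x: "x \<in> feasible_set P1 P2 \<sigma>"
    and \<xi>: "\<xi> \<in> subdifferential P2 x" and LO: "LO_output P1 P2 \<sigma> (gradf x) x \<xi> u"
  shows "0 \<le> FW_gap gradf P1 P2 \<sigma> x" and "FW_gap gradf P1 P2 \<sigma> x \<le> - (gradf x \<bullet> (u - x))"
proof -
  let ?s = "\<lambda>\<zeta>. SUP y\<in>feasible_approx P1 P2 \<sigma> x \<zeta>. gradf x \<bullet> (x - y)"
  have nonneg: "0 \<le> ?s \<zeta>" if \<zeta>: "\<zeta> \<in> subdifferential P2 x" for \<zeta>
  proof -
    obtain R where R: "\<And>z. z \<in> feasible_set P1 P2 \<sigma> \<Longrightarrow> norm (x - z) \<le> R"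
      using F by (metis bounded_any_center dist_norm)
    have "bdd_above ((\<lambda>y. gradf x \<bullet> (x - y)) ` feasible_approx P1 P2 \<sigma> x \<zeta>)"
    proof (rule bdd_aboveI2)
      fix y assume "y \<in> feasible_approx P1 P2 \<sigma> x \<zeta>"
      then have "norm (x - y) \<le> R" using R feasible_approx_subset_feasible[OF \<zeta>] by blast
      then have "norm (gradf x) * norm (x - y) \<le> norm (gradf x) * R"
        by (intro mult_left_mono) auto
      then show "gradf x \<bullet> (x - y) \<le> norm (gradf x) * R"
        using norm_cauchy_schwarz[of "gradf x" "x - y"] by linarith
    qed
    then have "gradf x \<bullet> (x - x) \<le> ?s \<zeta>"
      by (intro cSUP_upper center_in_feasible_approx x)
    then show ?thesis by simp
  qed
  show "0 \<le> FW_gap gradf P1 P2 \<sigma> x"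
    unfolding FW_gap_def using \<xi> nonneg by (intro cINF_greatest) auto
  have "FW_gap gradf P1 P2 \<sigma> x \<le> ?s \<xi>"
    unfolding FW_gap_def using \<xi> nonneg by (intro cINF_lower bdd_belowI2[where m = 0]) auto
  also have "\<dots> \<le> - (gradf x \<bullet> (u - x))"
  proof (rule cSUP_least)
    show "feasible_approx P1 P2 \<sigma> x \<xi> \<noteq> {}" using center_in_feasible_approx[OF x] by blast
    show "gradf x \<bullet> (x - y) \<le> - (gradf x \<bullet> (u - x))" if "y \<in> feasible_approx P1 P2 \<sigma> x \<xi>" for y
      using LO that unfolding LO_output_def is_arg_min_linorder by (simp add: inner_diff_right)
  qed
  finally show "FW_gap gradf P1 P2 \<sigma> x \<le> - (gradf x \<bullet> (u - x))" .
qed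

section \<open>Convergence rate\<close>

theorem theorem5:
  fixes f P1 P2 :: "'a::euclidean_space \<Rightarrow> real"
    and gradf :: "'a \<Rightarrow> 'a"
    and \<sigma> :: real
    and x :: "nat \<Rightarrow> 'a"
  assumes grad: "\<And>z. GDERIV f z :> gradf z"
    and grad_cont: "continuous_on UNIV gradf"
    and P1_convex: "convex_on UNIV P1"
    and P2_convex: "convex_on UNIV P2"
    and P1_strong: "strongly_convex_on UNIV P1"
    and sigma_pos: "\<sigma> > 0"
    and feas_nonempty: "feasible_set P1 P2 \<sigma> \<noteq> {}"
    and feas_compact: "compact (feasible_set P1 P2 \<sigma>)"
    and slater: "\<And>y \<xi>. y \<in> feasible_set P1 P2 \<sigma> \<Longrightarrow> \<xi> \<in> subdifferential P2 y \<Longrightarrow>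
                   \<exists>z. P1 z - P2 y - \<xi> \<bullet> (z - y) < \<sigma>"
    and grad_nonzero: "\<And>z. z \<in> feasible_set P1 P2 \<sigma> \<Longrightarrow> gradf z \<noteq> 0"
    and grad_lipschitz: "\<exists>L>0. \<forall>y\<in>feasible_set P1 P2 \<sigma>. \<forall>z\<in>feasible_set P1 P2 \<sigma>.
                   norm (gradf y - gradf z) \<le> L * norm (y - z)"
    and run: "FW_sequence f gradf P1 P2 \<sigma> x"
  shows "summable (\<lambda>k. FW_gap gradf P1 P2 \<sigma> (x k)) \<and>
         (\<lambda>k. real k * (MIN t\<in>{0..k}. FW_gap gradf P1 P2 \<sigma> (x t))) \<longlonglongrightarrow> 0"
proof -
  let ?F = "feasible_set P1 P2 \<sigma>"
  let ?G = "\<lambda>k. FW_gap gradf P1 P2 \<sigma> (x k)"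
  obtain c \<eta> :: real and \<alpha>0 \<xi> u d and \<alpha> :: "nat \<Rightarrow> real" and j :: "nat \<Rightarrow> nat" and xhat
    where c: "0 < c" "c < 1" and \<eta>: "0 < \<eta>" "\<eta> < 1"
      and \<alpha>0: "range \<alpha>0 \<subseteq> {0<..1}" "(INF k. \<alpha>0 k) > 0" and x0: "x 0 \<in> ?F"
      and step: "\<And>k. \<xi> k \<in> subdifferential P2 (x k) \<and>
             LO_output P1 P2 \<sigma> (gradf (x k)) (x k) (\<xi> k) (u k) \<and>
             d k = u k - x k \<and>
             gradf (x k) \<bullet> d k \<noteq> 0 \<and>
             \<alpha> k = \<alpha>0 k * \<eta> ^ j k \<and>
             armijo f gradf c (x k) (d k) (\<alpha> k) \<and>
             (\<forall>i<j k. \<not> armijo f gradf c (x k) (d k) (\<alpha>0 k * \<eta> ^ i)) \<and>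
             xhat (Suc k) = x k + \<alpha> k *\<^sub>R d k \<and>
             x (Suc k) \<in> ?F \<and> f (x (Suc k)) \<le> f (xhat (Suc k))"
    using run unfolding FW_sequence_def by (elim exE conjE) blast
  have xF: "x k \<in> ?F" for k using x0 step by (cases k) auto
  have bF: "bounded ?F" by (rule compact_imp_bounded[OF feas_compact])
  define g where "g = (\<lambda>k. gradf (x k))"
  define e where "e = (\<lambda>k. - (g k \<bullet> d k))"
  have gap: "0 \<le> ?G k" "?G k \<le> e k" for k
    using FW_gap_bounds[OF bF xF, of "\<xi> k" k gradf "u k"] step[of k] by (auto simp: e_def g_def)
  then have e0: "0 \<le> e k" for k by (rule order_trans)

  obtain \<delta> where \<delta>: "\<delta> > 0" "\<And>k. \<delta> \<le> norm (g k)"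
  proof -
    have "continuous_on ?F (\<lambda>z. norm (gradf z))"
      by (intro continuous_on_norm continuous_on_subset[OF grad_cont]) auto
    then obtain z where z: "z \<in> ?F" "\<forall>y\<in>?F. norm (gradf z) \<le> norm (gradf y)"
      using continuous_attains_inf[OF feas_compact feas_nonempty] by blast
    show thesis
      by (rule that[of "norm (gradf z)"]) (use z xF grad_nonzero in \<open>auto simp: g_def\<close>)
  qed
  obtain \<kappa> where \<kappa>: "\<kappa> > 0" and quad: "\<And>k. \<kappa> * norm (g k) * (norm (d k))\<^sup>2 \<le> e k"
    using LO_output_quadratic_decrease[OF P1_convex P2_convex P1_strong bF] step xF
    unfolding e_def g_def by metis
  have quad': "\<kappa> * \<delta> * (norm (d k))\<^sup>2 \<le> - (gradf (x k) \<bullet> d k)" for k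
  proof -
    have "\<kappa> * \<delta> * (norm (d k))\<^sup>2 \<le> \<kappa> * norm (g k) * (norm (d k))\<^sup>2"
      using \<kappa> \<delta> by (intro mult_right_mono mult_left_mono) auto
    with quad[of k] show ?thesis by (simp add: e_def g_def)
  qed

  obtain L where L: "L > 0"
    "\<And>y z. y \<in> ?F \<Longrightarrow> z \<in> ?F \<Longrightarrow> norm (gradf y - gradf z) \<le> L * norm (y - z)"
    using grad_lipschitz by blast
  (* The step up to which the linear model's error L * b\<^sup>2 * (norm d)\<^sup>2 is covered by the
     fraction 1 - c of the predicted decrease that the Armijo test leaves over. *)
  define \<tau> where "\<tau> = (1 - c) * (\<kappa> * \<delta>) / L"
  have \<tau>: "\<tau> > 0" using c \<kappa> \<delta> L by (simp add: \<tau>_def)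
  have small: "armijo f gradf c (x k) (d k) b" if b: "0 \<le> b" "b \<le> 1" "b \<le> \<tau>" for k b
  proof (rule armijo_if_small_step)
    let ?S = "feasible_approx P1 P2 \<sigma> (x k) (\<xi> k)"
    have sub: "?S \<subseteq> ?F" using feasible_approx_subset_feasible step by blast
    have "u k \<in> ?S" using step[of k] by (simp add: LO_output_def is_arg_min_linorder)
    then have "x k + d k \<in> ?S" using step[of k] by simp
    moreover have "norm (gradf y - gradf z) \<le> L * norm (y - z)" if "y \<in> ?S" "z \<in> ?S" for y z
      using L(2) sub that by blast
    ultimately show "f (x k + b *\<^sub>R d k)
        \<le> f (x k) + b * (gradf (x k) \<bullet> d k) + L * b\<^sup>2 * (norm (d k))\<^sup>2"
      using L(1) b center_in_feasible_approx[OF xF]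
      by (intro descent_on_segment[OF grad convex_feasible_approx[OF P1_convex]]) auto
    show "\<kappa> * \<delta> * (norm (d k))\<^sup>2 \<le> - (gradf (x k) \<bullet> d k)" by (rule quad')
    show "L * b \<le> (1 - c) * (\<kappa> * \<delta>)" using b L by (simp add: \<tau>_def field_simps)
  qed (use b c in auto)

  define a where "a = min (INF k. \<alpha>0 k) (\<eta> * \<tau>)"
  have a: "a > 0" using \<alpha>0 \<eta> \<tau> by (simp add: a_def)
  have a_le: "a \<le> \<alpha> k" for k
  proof -
    have \<alpha>0k: "0 < \<alpha>0 k" "\<alpha>0 k \<le> 1" using subsetD[OF \<alpha>0(1) rangeI[of \<alpha>0 k]] by auto
    have "bdd_below (range \<alpha>0)"
      by (rule bdd_below_mono[OF _ \<alpha>0(1)]) simp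
    then have "(INF k. \<alpha>0 k) \<le> \<alpha>0 k" by (rule cINF_lower) simp
    then have "a \<le> min (\<alpha>0 k) (\<eta> * \<tau>)" by (auto simp: a_def)
    also have "\<dots> \<le> \<alpha>0 k * \<eta> ^ j k"
    proof (rule backtracking_step_ge[where A = "armijo f gradf c (x k) (d k)"])
      show "\<not> armijo f gradf c (x k) (d k) (\<alpha>0 k * \<eta> ^ i)" if "i < j k" for i
        using step[of k] that by blast
    qed (use \<alpha>0k \<eta> small in auto)
    finally show ?thesis using step[of k] by simp
  qed

  have "continuous_on ?F f"
    using grad by (intro continuous_at_imp_continuous_on ballI)
      (auto simp: gderiv_def intro: has_derivative_continuous)
  then obtain z where z: "z \<in> ?F" "\<forall>y\<in>?F. f z \<le> f y"
    using continuous_attains_inf[OF feas_compact feas_nonempty] by blast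
  have "summable (\<lambda>k. c * a * e k)"
  proof (rule summable_of_telescoping[where v = "\<lambda>k. f (x k)" and B = "f z"])
    fix k
    show "0 \<le> c * a * e k" using c a e0 by simp
    have "c * a * e k \<le> c * \<alpha> k * e k"
      using a_le c e0 by (intro mult_right_mono mult_left_mono) auto
    moreover have "f (x (Suc k)) \<le> f (x k) + c * \<alpha> k * (gradf (x k) \<bullet> d k)"
      using step[of k] by (auto simp: armijo_def)
    ultimately show "c * a * e k \<le> f (x k) - f (x (Suc k))"
      by (simp add: e_def g_def)
    show "f z \<le> f (x k)" using z xF by blast
  qed
  then have "summable e" using c a by simp
  then have G: "summable ?G"
    by (rule summable_comparison_test'[where N = 0]) (simp add: gap)
  show ?thesis
    by (intro conjI G times_running_Min_tendsto_0 gap(1))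
qed

end
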